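(* Let \((X, \tau)\) be an ultrametrizable topological space. Then the following conditions are equivalent: (i) \((X, \tau)\) is separable. (ii) For every ultrametric \(d \colon X \times X \to \mathbb{R}^{+}\) compatible with \(\tau\), the distance set \(D(X, d)\) is at most countable.
   Context: \(\mathbb{R}^{+}\) is the set of all nonnegative real numbers. An ultrametric on \(X\) is a metric \(d\colon X\times X\to\mathbb{R}^{+}\) satisfying \(d(x,y)\leqslant\max\{d(x,z),d(z,y)\}\) for all \(x,y,z\in X\). An ultrametric \(d\) on \(X\) is compatible with a topology \(\tau\) on \(X\) if the set of all open balls \(B_r(c)=\{x\in X: d(c,x)<r\}\), \(c\in X\), \(r>0\), is an open base for \(\tau\) (i.e., \(\tau\) is the topology induced by \(d\)); \((X,\tau)\) is ultrametrizable if there is an ultrametric on \(X\) compatible with \(\tau\). The distance set of an ultrametric space \((X,d)\) is \(D(X,d)=\{d(x,y): x,y\in X\}\). A topological space is separable if it contains an at most countable (finite or countably infinite) dense subset. *)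

theory Defs
  imports "HOL-Analysis.Analysis"
begin

locale Ultrametric_space = Metric_space +
  assumes ultra: "\<lbrakk>x \<in> M; y \<in> M; z \<in> M\<rbrakk> \<Longrightarrow> d x y \<le> max (d x z) (d z y)"

(* The values of d outside the carrier topspace T are irrelevant: every ultrametric on the carrier
   extends (for instance by 0) to a nonnegative symmetric function, as Metric_space requires. *)
definition compatible_ultrametric :: "'a topology \<Rightarrow> ('a \<Rightarrow> 'a \<Rightarrow> real) \<Rightarrow> bool"
  where "compatible_ultrametric T d \<longleftrightarrow>
    Ultrametric_space (topspace T) d \<and>
    openin T = arbitrary union_of
      (\<lambda>U. \<exists>c \<in> topspace T. \<exists>r > 0. U = Metric_space.mball (topspace T) d c r)"

definition ultrametrizable_space :: "'a topology \<Rightarrow> bool"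
  where "ultrametrizable_space T \<longleftrightarrow> (\<exists>d. compatible_ultrametric T d)"

definition distance_set :: "'a set \<Rightarrow> ('a \<Rightarrow> 'a \<Rightarrow> real) \<Rightarrow> real set"
  where "distance_set M d = {d x y | x y. x \<in> M \<and> y \<in> M}"

lemma compatible_ultrametric_iff_mtopology:
  "compatible_ultrametric T d \<longleftrightarrow>
    Ultrametric_space (topspace T) d \<and> T = Metric_space.mtopology (topspace T) d"
proof (cases "Ultrametric_space (topspace T) d")
  case True
  then interpret Ultrametric_space "topspace T" d .
  let ?B = "\<lambda>U. \<exists>c \<in> topspace T. \<exists>r > 0. U = mball c r"
  have "openin mtopology = arbitrary union_of ?B"
  proof (subst openin_topology_base_unique, intro conjI allI impI)
    fix V assume "?B V"
    then show "openin mtopology V" using openin_mball by blast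
  next
    fix U x assume "openin mtopology U \<and> x \<in> U"
    then obtain r where "r > 0" "mball x r \<subseteq> U" "x \<in> topspace T"
      by (metis openin_mtopology subsetD)
    then show "\<exists>V. ?B V \<and> x \<in> V \<and> V \<subseteq> U"
      using centre_in_mball_iff by blast
  qed
  then have "openin T = arbitrary union_of ?B \<longleftrightarrow> T = mtopology"
    by (metis openin_inverse)
  with True show ?thesis
    by (simp add: compatible_ultrametric_def)
qed (simp add: compatible_ultrametric_def)

end

theory Submission
  imports Defs
begin

text \<open>
  In an ultrametric space, moving the two endpoints of a positive distance \<open>r\<close> by less than \<open>r\<close>
  does not change the distance.  So every positive distance is already attained on a dense subset,
  and a countable dense subset leaves room for countably many distances only
  (\<open>distance_set_subset_of_dense\<close>).

  Conversely, for each \<open>e > 0\<close> the balls of radius \<open>e\<close> partition the space.  If each of these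
  partitions is countable, picking one point per ball for \<open>e = 1, 1/2, 1/3, \<dots>\<close> gives a countable
  dense set.  Hence, in a space that is not separable, some \<open>e\<close> yields uncountably many balls.  The
  distances below \<open>e\<close> alone determine the topology, so the larger ones can be redesigned: give
  every ball a height of at least \<open>e\<close>, and let two points of different balls be as far apart as the
  larger of the two heights (\<open>reheight\<close>).  This is again a compatible ultrametric, and all heights,
  except possibly the least, occur as distances.  Since an uncountable set can be mapped onto
  uncountably many reals (\<open>uncountable_real_image\<close>), the heights can be chosen so that the new
  distance set is uncountable.
\<close>

section \<open>Distances and dense subsets\<close>

context Ultrametric_space
begin

text \<open>Triangles are isosceles: otherwise the longest side would exceed both of the others.\<close>

lemma dist_eq_if_less:
  assumes "x \<in> M" "y \<in> M" "z \<in> M" "d x y < d x z"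
  shows "d y z = d x z"
  using ultra[of x z y] ultra[of y z x] assms by (auto simp: commute max_def split: if_splits)

lemma distance_set_subset_of_dense:
  assumes "S \<subseteq> M" and dense: "\<And>x r. \<lbrakk>x \<in> M; r > 0\<rbrakk> \<Longrightarrow> \<exists>s\<in>S. d x s < r"
  shows "distance_set M d \<subseteq> insert 0 (case_prod d ` (S \<times> S))"
proof
  fix v assume "v \<in> distance_set M d"
  then obtain x y where xy: "x \<in> M" "y \<in> M" and v: "v = d x y"
    by (auto simp: distance_set_def)
  show "v \<in> insert 0 (case_prod d ` (S \<times> S))"
  proof (cases "v = 0")
    case False
    then have "d x y > 0" using v nonneg[of x y] by linarith
    then obtain s t where s: "s \<in> S" "d x s < d x y" and t: "t \<in> S" "d y t < d x y"
      using dense xy by meson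
    have "d s y = d x y"
      using dist_eq_if_less[of x s y] s xy \<open>S \<subseteq> M\<close> by auto
    moreover have "d t s = d y s"
      using dist_eq_if_less[of y t s] s t xy \<open>S \<subseteq> M\<close> \<open>d s y = d x y\<close> by (auto simp: commute)
    ultimately have "v = d s t" using v by (simp add: commute)
    then show ?thesis using s t by auto
  qed simp
qed

lemma mball_eq_if_mem:
  assumes "x \<in> M" "y \<in> M" "d x y < e"
  shows "mball x e = mball y e"
  using ultra[of x _ y] ultra[of y _ x] assms by (fastforce simp: in_mball commute)

end

context Metric_space
begin

lemma separable_space_mtopologyE:
  assumes "separable_space mtopology"
  obtains S where "countable S" "S \<subseteq> M" "\<And>x r. \<lbrakk>x \<in> M; r > 0\<rbrakk> \<Longrightarrow> \<exists>s\<in>S. d x s < r"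
proof -
  obtain S where S: "countable S" "S \<subseteq> M" "mtopology closure_of S = M"
    using assms by (auto simp: separable_space_def)
  then have "\<exists>s\<in>S. d x s < r" if "x \<in> M" "r > 0" for x r
  proof -
    have "x \<in> mtopology closure_of S" using S(3) \<open>x \<in> M\<close> by simp
    then show ?thesis using \<open>r > 0\<close> by (auto simp: metric_closure_of in_mball)
  qed
  with S that show thesis by blast
qed

text \<open>Countably many balls of each radius have countably many centres that are dense together.\<close>

lemma separable_space_if_countable_balls:
  assumes countable_balls: "\<And>e. e > 0 \<Longrightarrow> countable ((\<lambda>x. mball x e) ` M)"
  shows "separable_space mtopology"
proof -
  define e where "e n = inverse (real (Suc n))" for n
  define c where "c n = inv_into M (\<lambda>x. mball x (e n))" for n
  define S where "S = (\<Union>n. c n ` (\<lambda>x. mball x (e n)) ` M)"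
  have e_pos: "e n > 0" for n by (simp add: e_def)
  have "countable S"
    unfolding S_def using countable_balls[OF e_pos] by blast
  have "S \<subseteq> M"
    unfolding S_def c_def by (auto intro: inv_into_into)
  have "\<exists>s\<in>S. s \<in> mball x r" if "x \<in> M" "r > 0" for x r
  proof -
    obtain n where n: "e n < r"
      using reals_Archimedean[OF \<open>r > 0\<close>] by (auto simp: e_def)
    let ?s = "c n (mball x (e n))"
    have "mball ?s (e n) = mball x (e n)"
      unfolding c_def using \<open>x \<in> M\<close> by (intro f_inv_into_f[where f = "\<lambda>x. mball x (e n)"]) auto
    then have "x \<in> mball ?s (e n)"
      using \<open>x \<in> M\<close> e_pos by simp
    then have "?s \<in> mball x r" using n by (auto simp: in_mball commute)
    moreover have "?s \<in> S" using \<open>x \<in> M\<close> by (auto simp: S_def)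
    ultimately show ?thesis by blast
  qed
  then have "mtopology closure_of S = M"
    by (auto simp: metric_closure_of)
  with \<open>countable S\<close> \<open>S \<subseteq> M\<close> show ?thesis
    by (auto simp: separable_space_def)
qed

end

section \<open>Redesigning the large distances\<close>

lemma mtopology_eq_if_small_distances_agree:
  assumes "Metric_space M d" "Metric_space M d'" "e > 0"
    and agree: "\<And>x y r. \<lbrakk>x \<in> M; y \<in> M; r \<le> e\<rbrakk> \<Longrightarrow> d' x y < r \<longleftrightarrow> d x y < r"
  shows "Metric_space.mtopology M d' = Metric_space.mtopology M d"
proof -
  interpret d: Metric_space M d by fact
  interpret d': Metric_space M d' by fact
  have ball_eq: "d'.mball x (min r e) = d.mball x (min r e)" for x r
    unfolding d.mball_def d'.mball_def using agree[OF _ _ min.cobounded2] by blast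
  have shrink: "d'.mball x (min r e) \<subseteq> d'.mball x r" "d.mball x (min r e) \<subseteq> d.mball x r" for x r
    by auto
  have pos: "min r e > 0" if "r > 0" for r using that \<open>e > 0\<close> by simp
  have "openin d'.mtopology U \<longleftrightarrow> openin d.mtopology U" for U
    unfolding d.openin_mtopology d'.openin_mtopology
    using ball_eq shrink pos by (metis order_trans)
  then show ?thesis by (simp add: topology_eq)
qed

definition reheight :: "('a \<Rightarrow> 'a \<Rightarrow> real) \<Rightarrow> real \<Rightarrow> ('a \<Rightarrow> real) \<Rightarrow> 'a \<Rightarrow> 'a \<Rightarrow> real"
  where "reheight d e f x y = (if d x y < e then d x y else max (f x) (f y))"

text \<open>
  Heights must be at least \<open>e\<close>, so that distances between different balls dominate those inside a
  ball, and constant on each ball of radius \<open>e\<close>, so that moving inside a ball does not affect the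
  distance to other balls.
\<close>

locale height_function = Ultrametric_space +
  fixes e :: real and f :: "'a \<Rightarrow> real"
  assumes e_pos: "e > 0" and height_ge: "\<And>x. e \<le> f x"
    and height_const: "\<And>x y. \<lbrakk>x \<in> M; y \<in> M; d x y < e\<rbrakk> \<Longrightarrow> f x = f y"
begin

lemma reheight_less_iff: "r \<le> e \<Longrightarrow> reheight d e f x y < r \<longleftrightarrow> d x y < r"
  using height_ge[of x] by (auto simp: reheight_def max_def split: if_splits)

lemma height_le_reheight: "\<not> d x y < e \<Longrightarrow> f x \<le> reheight d e f x y \<and> f y \<le> reheight d e f x y"
  by (simp add: reheight_def)

lemma reheight_nonneg: "0 \<le> reheight d e f x y"
  using reheight_less_iff[of 0 x y] e_pos nonneg[of x y] by auto

lemma reheight_ultra: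
  assumes "x \<in> M" "y \<in> M" "z \<in> M"
  shows "reheight d e f x y \<le> max (reheight d e f x z) (reheight d e f z y)"
proof (cases "d x y < e")
  case True
  then have eq: "reheight d e f x y = d x y" by (simp add: reheight_def)
  show ?thesis
  proof (cases "d x z < e \<and> d z y < e")
    case True
    with eq ultra[OF assms] show ?thesis by (simp add: reheight_def)
  next
    case False
    \<comment> \<open>a detour outside the ball costs at least \<open>e\<close>\<close>
    then have "e \<le> max (reheight d e f x z) (reheight d e f z y)"
      using reheight_less_iff[of e x z] reheight_less_iff[of e z y] by auto
    with True eq show ?thesis by simp
  qed
next
  case False
  then have eq: "reheight d e f x y = max (f x) (f y)" by (simp add: reheight_def)
  have apart: "\<not> d x z < e \<or> \<not> d z y < e"
    using False ultra[OF assms] by auto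
  \<comment> \<open>on either leg that stays inside a ball, the height is carried over to \<open>z\<close>\<close>
  have "f x \<le> max (reheight d e f x z) (reheight d e f z y)"
    using apart height_le_reheight[of x z] height_le_reheight[of z y] height_const[of x z] assms
    by (cases "d x z < e") auto
  moreover have "f y \<le> max (reheight d e f x z) (reheight d e f z y)"
    using apart height_le_reheight[of x z] height_le_reheight[of z y] height_const[of z y] assms
    by (cases "d z y < e") auto
  ultimately show ?thesis using eq by simp
qed

lemma Ultrametric_space_reheight: "Ultrametric_space M (reheight d e f)"
proof
  fix x y z
  show "0 \<le> reheight d e f x y" by (rule reheight_nonneg)
  show "reheight d e f x y = reheight d e f y x"
    by (simp add: reheight_def commute max.commute)
  assume "x \<in> M" "y \<in> M"
  then show "reheight d e f x y = 0 \<longleftrightarrow> x = y"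
    using height_ge[of x] e_pos zero[of x y] by (auto simp: reheight_def max_def)
  assume "z \<in> M"
  with \<open>x \<in> M\<close> \<open>y \<in> M\<close> show "reheight d e f x y \<le> max (reheight d e f x z) (reheight d e f z y)"
    by (rule reheight_ultra)
  show "reheight d e f x z \<le> reheight d e f x y + reheight d e f y z"
    using reheight_ultra[OF \<open>x \<in> M\<close> \<open>z \<in> M\<close> \<open>y \<in> M\<close>] reheight_nonneg[of x y] reheight_nonneg[of y z]
    by linarith
qed

lemma mtopology_reheight: "Metric_space.mtopology M (reheight d e f) = mtopology"
proof (rule mtopology_eq_if_small_distances_agree[OF _ _ e_pos])
  show "Metric_space M d" ..
  show "Metric_space M (reheight d e f)"
    using Ultrametric_space_reheight by (simp add: Ultrametric_space_def)
qed (rule reheight_less_iff)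

text \<open>
  A height \<open>f y\<close> is the distance from \<open>y\<close> to any point of smaller height; only the least
  height, which is the infimum if it exists, may lack such a point.
\<close>

lemma heights_subset_distance_set:
  "f ` M \<subseteq> insert (Inf (f ` M)) (distance_set M (reheight d e f))"
proof
  fix v assume "v \<in> f ` M"
  then obtain y where y: "y \<in> M" "v = f y" by blast
  show "v \<in> insert (Inf (f ` M)) (distance_set M (reheight d e f))"
  proof (cases "\<exists>x\<in>M. f x < v")
    case True
    then obtain x where x: "x \<in> M" "f x < v" by blast
    then have "\<not> d x y < e" using height_const[of x y] y by auto
    then have "v = reheight d e f x y" using x y by (simp add: reheight_def)
    then show ?thesis using x y by (auto simp: distance_set_def)
  next
    case False
    then have "Inf (f ` M) = v"
      using \<open>v \<in> f ` M\<close> by (intro cInf_eq_minimum) (auto simp: not_less)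
    then show ?thesis by simp
  qed
qed

end

section \<open>The equivalence\<close>

text \<open>
  Any two cardinals are comparable: either the set embeds into the reals, or the reals embed into
  the set, and then a left inverse of the embedding attains every real.
\<close>

lemma uncountable_real_image:
  assumes "uncountable A"
  shows "\<exists>h :: 'a \<Rightarrow> real. uncountable (h ` A)"
proof -
  consider h :: "'a \<Rightarrow> real" where "inj_on h A"
    | g :: "real \<Rightarrow> 'a" where "inj g" "range g \<subseteq> A"
    using ordLeq_total[OF card_of_Well_order[of A] card_of_Well_order[of "UNIV :: real set"]]
    by (metis card_of_ordLeq)
  then show ?thesis
  proof cases
    case 1
    with assms show ?thesis by (metis countable_image_inj_on)
  next
    case 2
    then have "inv g ` A = UNIV"
      by (metis UNIV_eq_I image_eqI inv_f_f range_subsetD)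
    then show ?thesis using uncountable_UNIV_real by metis
  qed
qed

lemma (in Ultrametric_space) compatible_uncountable_distance_set:
  assumes "\<not> separable_space mtopology"
  obtains d' where "Ultrametric_space M d'" "Metric_space.mtopology M d' = mtopology"
    "uncountable (distance_set M d')"
proof -
  obtain e where e: "e > 0" "uncountable ((\<lambda>x. mball x e) ` M)"
    using assms separable_space_if_countable_balls by blast
  obtain h :: "'a set \<Rightarrow> real" where h: "uncountable (h ` (\<lambda>x. mball x e) ` M)"
    using uncountable_real_image[OF e(2)] by blast
  \<comment> \<open>\<open>exp\<close> moves the real labels of the balls injectively above \<open>e\<close>\<close>
  define f where "f x = e + exp (h (mball x e))" for x
  have "f ` M = (\<lambda>t. e + exp t) ` h ` (\<lambda>x. mball x e) ` M"
    by (simp add: f_def image_image)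
  moreover have "inj_on (\<lambda>t::real. e + exp t) B" for B
    by (simp add: inj_on_def)
  ultimately have "uncountable (f ` M)"
    using h by (metis countable_image_inj_on)
  interpret height_function M d e f
  proof
    show "e > 0" by fact
    show "e \<le> f x" for x by (simp add: f_def)
    show "f x = f y" if "x \<in> M" "y \<in> M" "d x y < e" for x y
      using mball_eq_if_mem[OF that] by (simp add: f_def)
  qed
  have "uncountable (distance_set M (reheight d e f))"
    using \<open>uncountable (f ` M)\<close> heights_subset_distance_set
    by (metis countable_insert countable_subset)
  then show thesis
    using that Ultrametric_space_reheight mtopology_reheight by blast
qed

theorem theorem4p12:
  fixes T :: "'a topology"
  assumes "ultrametrizable_space T"
  shows "separable_space T \<longleftrightarrow>
    (\<forall>d. compatible_ultrametric T d \<longrightarrow> countable (distance_set (topspace T) d))"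
proof (intro iffI allI impI)
  fix d
  assume sep: "separable_space T" and d: "compatible_ultrametric T d"
  then interpret Ultrametric_space "topspace T" d
    by (simp add: compatible_ultrametric_iff_mtopology)
  have "separable_space mtopology"
    using sep d by (simp add: compatible_ultrametric_iff_mtopology)
  then obtain S where S: "countable S" "S \<subseteq> topspace T"
    "\<And>x r. \<lbrakk>x \<in> topspace T; r > 0\<rbrakk> \<Longrightarrow> \<exists>s\<in>S. d x s < r"
    using separable_space_mtopologyE by blast
  have "countable (insert 0 (case_prod d ` (S \<times> S)))"
    using S(1) by simp
  then show "countable (distance_set (topspace T) d)"
    using distance_set_subset_of_dense[OF S(2,3)] countable_subset by blast
next
  assume countable_distances:
    "\<forall>d. compatible_ultrametric T d \<longrightarrow> countable (distance_set (topspace T) d)"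
  obtain d where d: "Ultrametric_space (topspace T) d" "T = Metric_space.mtopology (topspace T) d"
    using assms by (auto simp: ultrametrizable_space_def compatible_ultrametric_iff_mtopology)
  interpret Ultrametric_space "topspace T" d by fact
  show "separable_space T"
  proof (rule ccontr)
    assume "\<not> separable_space T"
    then have "\<not> separable_space mtopology" using d(2) by simp
    then obtain d' where "Ultrametric_space (topspace T) d'"
      "Metric_space.mtopology (topspace T) d' = mtopology"
      "uncountable (distance_set (topspace T) d')"
      by (rule compatible_uncountable_distance_set)
    with countable_distances d(2) show False
      by (simp add: compatible_ultrametric_iff_mtopology)
  qed
qed

end
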